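(* Let $A_2(n)$ denote the number of simply paired partitions of $n$ having pairing rank $-2$. For every $n\geq 0$, $$A_2(16n)\equiv0,\qquad A_2(16n+4)\equiv1,\qquad A_2(16n+8)\equiv1,\qquad A_2(16n+12)\equiv0\pmod 2.$$
   Context: A partition is simply paired if no part occurs more than three times. For a partition $\lambda$, let $r(\lambda)$ be the largest part size of multiplicity at least $2$ ($r(\lambda)=0$ if $\lambda$ has distinct parts). Let $u_1>u_2>\cdots$ be the part sizes occurring with odd multiplicity, each taken once, and let $s(\lambda)=u_1-u_2+u_3-u_4+\cdots$ ($0$ if there are none). The pairing rank is $\rho(\lambda)=r(\lambda)-s(\lambda)$. *)

theory Defs
  imports "HOL-Library.Multiset" "HOL-Number_Theory.Cong"
begin

text \<open>A partition \<open>p\<close> is the multiset of its parts, so that \<open>count p i\<close> is the multiplicity of \<open>i\<close>.\<close>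

definition partitions_of :: "nat \<Rightarrow> nat multiset set" where
  "partitions_of n = {p. 0 \<notin># p \<and> sum_mset p = n}"

definition simply_paired :: "nat multiset \<Rightarrow> bool" where
  "simply_paired p \<longleftrightarrow> (\<forall>i. count p i \<le> 3)"

definition largest_repeated :: "nat multiset \<Rightarrow> nat" where
  "largest_repeated p =
     (if \<exists>i. count p i \<ge> 2 then Max {i. count p i \<ge> 2} else 0)"

definition odd_multiplicity_parts :: "nat multiset \<Rightarrow> nat list" where
  "odd_multiplicity_parts p = rev (sorted_list_of_set {i. odd (count p i)})"

text \<open>\<open>u\<^sub>1 - u\<^sub>2 + u\<^sub>3 - \<dots>\<close> over the decreasing list; \<open>u\<^sub>1\<close> sits at position 0.\<close>

definition odd_alt_sum :: "nat multiset \<Rightarrow> int" where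
  "odd_alt_sum p =
     (\<Sum>i<length (odd_multiplicity_parts p). (- 1) ^ i * int (odd_multiplicity_parts p ! i))"

definition pairing_rank :: "nat multiset \<Rightarrow> int" where
  "pairing_rank p = int (largest_repeated p) - odd_alt_sum p"

definition A2 :: "nat \<Rightarrow> nat" where
  "A2 n = card {p \<in> partitions_of n. simply_paired p \<and> pairing_rank p = - 2}"

end

theory Submission
  imports Defs "HOL-Computational_Algebra.Formal_Power_Series" "HOL-Library.Z2"
begin

text \<open>
  Separating the parts of odd multiplicity from the repeated parts turns a simply paired partition
  into a pair \<open>(U, R)\<close> of finite sets of positive integers, of size \<open>\<Sum>U + 2 \<Sum>R\<close> and pairing rank
  \<open>max R - alt U\<close>. Sets \<open>U\<close> with alternating sum \<open>s\<close> have generating function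
  \<open>q\<^sup>s / \<Prod>i\<le>s. (1 - q\<^bsup>2i\<^esup>)\<close>, and modulo 2 the sets \<open>R\<close> with maximum \<open>r > 0\<close> have
  \<open>q\<^bsup>2r\<^esup> \<Prod>i<r. (1 - q\<^bsup>2i\<^esup>)\<close>. Hence the generating function of \<open>A2\<close> is congruent to
  \<open>q\<^sup>2 / ((1 - q\<^sup>2) (1 - q\<^sup>4)) + \<Sum>r\<ge>1. q\<^bsup>3r+2\<^esup> / ((1 - q\<^bsup>2r\<^esup>) (1 - q\<^bsup>2r+2\<^esup>) (1 - q\<^bsup>2r+4\<^esup>))\<close>.
  At \<open>q\<^bsup>4M\<^esup>\<close> the first term gives \<open>M\<close>. In the sum only even \<open>r\<close> contribute, and after a
  characteristic 2 partial fraction the coefficient counts odd \<open>d \<le> N = 4M + 1\<close> whose remainder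
  \<open>t = N - 2 d f\<close> of least absolute value satisfies \<open>t \<equiv> 3, 5 (mod 8)\<close>, except for
  \<open>\<lfloor>(M + 1) / 2\<rfloor>\<close> of them with \<open>f = 1\<close>. Here \<open>f\<close> is the number of odd \<open>e\<close> with \<open>d e \<le> N\<close>, so
  the number of all such \<open>d\<close> is \<open>M (2M + 1)\<close> plus the numbers of odd pairs \<open>(d, e)\<close> with
  \<open>d e \<le> N\<close> and \<open>e \<equiv> 3\<close>, respectively \<open>d \<equiv> 3 (mod 4)\<close>. These two are equal, so that
  \<open>A2 (4M) \<equiv> M + \<lfloor>M / 2\<rfloor> (mod 2)\<close>.
\<close>

section \<open>Subsets of an initial segment by alternating sum\<close>

unbundle fps_syntax

definition alt_sum :: "nat set \<Rightarrow> int" where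
  "alt_sum U = (let us = rev (sorted_list_of_set U) in
     \<Sum>i<length us. (- 1) ^ i * int (us ! i))"

lemma alt_sum_empty [simp]: "alt_sum {} = 0"
  by (simp add: alt_sum_def)

text \<open>Reversing the sorted list puts the new maximum at position 0 and moves every other entry
  one place on, which flips its sign.\<close>

lemma alt_sum_insert_greater:
  assumes "finite U" "\<And>u. u \<in> U \<Longrightarrow> u < n"
  shows "alt_sum (insert n U) = int n - alt_sum U"
proof -
  have "n \<notin> U"
    using assms(2) by blast
  then have "sorted_list_of_set (insert n U) = sorted_list_of_set U @ [n]"
    using assms by (auto simp: sorted_list_of_set_insert_remove intro!: sorted_insort_is_snoc less_imp_le)
  then show ?thesis
    by (simp add: alt_sum_def Let_def sum.lessThan_Suc_shift sum_negf del: sum.lessThan_Suc)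
qed

lemma alt_sum_bounds:
  assumes "U \<subseteq> {1..n}"
  shows "0 \<le> alt_sum U \<and> alt_sum U \<le> int n"
  using assms
proof (induction n arbitrary: U)
  case (Suc n)
  show ?case
  proof (cases "Suc n \<in> U")
    case True
    let ?V = "U - {Suc n}"
    have V: "?V \<subseteq> {1..n}"
      using Suc.prems by (auto simp: le_Suc_eq)
    moreover have "finite ?V"
      using V finite_subset by blast
    moreover have "U = insert (Suc n) ?V"
      using True by blast
    ultimately have "alt_sum U = int (Suc n) - alt_sum ?V"
      using alt_sum_insert_greater[of ?V "Suc n"] by fastforce
    then show ?thesis
      using Suc.IH[OF V] by linarith
  next
    case False
    then have "U \<subseteq> {1..n}"
      using Suc.prems by (auto simp: le_Suc_eq)
    from Suc.IH[OF this] show ?thesis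
      by simp
  qed
qed auto

lemma inj_on_insert_Suc: "inj_on (insert (Suc n)) (Pow {1..n})"
proof (rule inj_onI)
  fix U V
  assume "U \<in> Pow {1..n}" "V \<in> Pow {1..n}" and eq: "insert (Suc n) U = insert (Suc n) V"
  then have "Suc n \<notin> U" "Suc n \<notin> V"
    by auto
  with eq show "U = V"
    by (simp add: insert_ident)
qed

lemma Pow_atLeastAtMost_Suc:
  "Pow {1..Suc n} = Pow {1..n} \<union> insert (Suc n) ` Pow {1..n}"
  by (simp add: atLeastAtMostSuc_conv Pow_insert)

lemma sum_insert_Suc:
  assumes "U \<subseteq> {1..n}"
  shows "\<Sum>(insert (Suc n) U) = Suc n + \<Sum>U"
  using assms finite_subset[OF assms] by (subst sum.insert) auto

definition alt_gf :: "nat \<Rightarrow> nat \<Rightarrow> 'a :: idom fps" where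
  "alt_gf n s = (\<Sum>U \<in> {U \<in> Pow {1..n}. alt_sum U = int s}. fps_X ^ \<Sum>U)"

text \<open>The q-Pochhammer symbol (q^2; q^2)_n, with \<open>fps_X\<close> as q.\<close>

definition even_prod :: "nat \<Rightarrow> 'a :: idom fps" where
  "even_prod n = (\<Prod>i = 1..n. 1 - fps_X ^ (2 * i))"

lemma even_prod_0 [simp]: "even_prod 0 = 1"
  by (simp add: even_prod_def)

lemma even_prod_Suc: "even_prod (Suc n) = even_prod n * (1 - fps_X ^ (2 * Suc n))"
  by (simp add: even_prod_def)

lemma one_minus_X_power_nz: "n > 0 \<Longrightarrow> 1 - fps_X ^ n \<noteq> (0 :: 'a :: idom fps)"
proof -
  assume "n > 0"
  then have "(1 - fps_X ^ n :: 'a fps) $ 0 = 1"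
    by simp
  then show ?thesis
    by (metis fps_zero_nth zero_neq_one)
qed

lemma even_prod_nz: "even_prod n \<noteq> (0 :: 'a :: idom fps)"
proof -
  have "1 - fps_X ^ (2 * i) \<noteq> (0 :: 'a fps)" if "i \<in> {1..n}" for i
    using that by (intro one_minus_X_power_nz) auto
  then show ?thesis
    unfolding even_prod_def by (subst prod_zero_iff) blast+
qed

lemma alt_gf_0: "alt_gf 0 s = (if s = 0 then 1 else 0)"
proof -
  have "{U \<in> Pow {1..0}. alt_sum U = int s} = (if s = 0 then {{}} else {})"
    by auto
  then show ?thesis
    by (simp add: alt_gf_def)
qed

lemma alt_gf_eq_0:
  assumes "n < s"
  shows "alt_gf n s = 0"
proof -
  have "alt_sum U \<noteq> int s" if "U \<subseteq> {1..n}" for U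
    using alt_sum_bounds[OF that] assms by linarith
  then have "{U \<in> Pow {1..n}. alt_sum U = int s} = {}"
    by blast
  then show ?thesis
    unfolding alt_gf_def by (simp only: sum.empty)
qed

text \<open>Split by membership of \<open>Suc n\<close>: deleting it as the maximum turns
  alternating sum \<open>s\<close> into \<open>Suc n - s\<close>.\<close>

lemma alt_gf_Suc:
  assumes "s \<le> Suc n"
  shows "alt_gf (Suc n) s = alt_gf n s + fps_X ^ Suc n * alt_gf n (Suc n - s)"
proof -
  let ?A = "{U \<in> Pow {1..n}. alt_sum U = int s}"
  let ?B = "{U \<in> Pow {1..n}. alt_sum U = int (Suc n - s)}"
  have alt: "alt_sum (insert (Suc n) U) = int (Suc n) - alt_sum U" if "U \<subseteq> {1..n}" for U
    using that finite_subset[OF that] by (intro alt_sum_insert_greater) auto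
  have eq: "{U \<in> Pow {1..Suc n}. alt_sum U = int s} = ?A \<union> insert (Suc n) ` ?B"
    using assms unfolding Pow_atLeastAtMost_Suc by (auto simp: alt of_nat_diff)
  have inj: "inj_on (insert (Suc n)) ?B"
    using inj_on_insert_Suc by (rule inj_on_subset) auto
  have "alt_gf (Suc n) s = alt_gf n s + (\<Sum>U \<in> insert (Suc n) ` ?B. fps_X ^ \<Sum>U)"
    unfolding alt_gf_def eq by (rule sum.union_disjoint) auto
  also have "(\<Sum>U \<in> insert (Suc n) ` ?B. fps_X ^ \<Sum>U) = (\<Sum>U \<in> ?B. fps_X ^ (Suc n + \<Sum>U))"
    by (subst sum.reindex[OF inj]) (simp add: sum_insert_Suc)
  also have "\<dots> = fps_X ^ Suc n * alt_gf n (Suc n - s)"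
    by (simp only: alt_gf_def sum_distrib_left power_add)
  finally show ?thesis .
qed

text \<open>Cleared of denominators, this says that \<open>alt_gf n s\<close> is q^s times the
  Gaussian binomial [n choose s] in q^2. The index \<open>Suc n - s\<close> in
  \<open>alt_gf_Suc\<close> yields, by symmetry, the binomial [n choose s - 1], so that recursion is
  the q-Pascal rule.\<close>

lemma alt_gf_even_prod:
  assumes "s \<le> n"
  shows "alt_gf n s * even_prod s * even_prod (n - s) = (fps_X :: 'a :: idom fps) ^ s * even_prod n"
  using assms
proof (induction n arbitrary: s)
  case 0
  then show ?case by (simp add: alt_gf_0)
next
  case (Suc n)
  consider "s = 0" | "s = Suc n" | t where "s = Suc t" "s \<le> n"
    using Suc.prems by (cases s) (auto simp: le_Suc_eq)
  then show ?case
  proof cases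
    case 1
    have "even_prod (Suc n) * alt_gf n 0 = (even_prod (Suc n) :: 'a fps)"
      using Suc.IH[of 0] by (simp add: even_prod_nz)
    then show ?thesis using 1
      by (simp add: alt_gf_Suc alt_gf_eq_0 mult.commute)
  next
    case 2
    have "alt_gf n 0 = (1 :: 'a fps)"
      using Suc.IH[of 0] by (simp add: even_prod_nz)
    then show ?thesis using 2
      by (simp add: alt_gf_Suc alt_gf_eq_0)
  next
    case 3
    define a where "a = n - s"
    have n: "n = Suc t + a" using 3 a_def by simp
    have IH1: "alt_gf n s * even_prod s * even_prod a = (fps_X :: 'a fps) ^ s * even_prod n"
      using Suc.IH[of s] 3 a_def by simp
    have IH2: "alt_gf n (Suc a) * even_prod (Suc a) * even_prod t = (fps_X :: 'a fps) ^ Suc a * even_prod n"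
      using Suc.IH[of "Suc a"] n by simp
    have "Suc n - s = Suc a"
      using 3 a_def by simp
    then have "alt_gf (Suc n) s * even_prod s * even_prod (Suc n - s)
      = (alt_gf n s + (fps_X :: 'a fps) ^ Suc n * alt_gf n (Suc a)) * even_prod s * even_prod (Suc a)"
      using \<open>s \<le> n\<close> by (simp add: alt_gf_Suc)
    also have "\<dots> = (alt_gf n s * even_prod s * even_prod a) * (1 - fps_X ^ (2 * Suc a))
        + (fps_X :: 'a fps) ^ Suc n * (alt_gf n (Suc a) * even_prod (Suc a) * even_prod t)
          * (1 - fps_X ^ (2 * Suc t))"
      unfolding \<open>s = Suc t\<close> even_prod_Suc by algebra
    also have "\<dots> = even_prod n * (fps_X ^ s * (1 - fps_X ^ (2 * Suc a))
        + fps_X ^ (Suc n + Suc a) * (1 - fps_X ^ (2 * Suc t)))"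
      unfolding IH1 IH2 power_add by algebra
    also have "fps_X ^ s * (1 - fps_X ^ (2 * Suc a))
        + fps_X ^ (Suc n + Suc a) * (1 - fps_X ^ (2 * Suc t))
        = fps_X ^ s * (1 - fps_X ^ (2 * Suc n) :: 'a fps)"
    proof -
      have "s + 2 * Suc a = Suc n + Suc a" "Suc n + Suc a + 2 * Suc t = s + 2 * Suc n"
        using 3 n by simp_all
      then show ?thesis
        by (simp only: right_diff_distrib mult_1_right flip: power_add) simp
    qed
    finally show ?thesis
      by (simp add: even_prod_Suc mult_ac)
  qed
qed

section \<open>Simply paired partitions as pairs of sets\<close>

text \<open>Adjoining 0 reproduces the value 0 that \<open>largest_repeated\<close> takes on
  distinct parts.\<close>

definition max0 :: "nat set \<Rightarrow> nat" where
  "max0 R = Max (insert 0 R)"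

definition set_pairs :: "nat \<Rightarrow> (nat set \<times> nat set) set" where
  "set_pairs n = {(U, R). finite U \<and> finite R \<and> 0 \<notin> U \<and> 0 \<notin> R \<and>
     \<Sum>U + 2 * \<Sum>R = n \<and> alt_sum U = int (max0 R) + 2}"

lemma sum_mset_mset_set: "sum_mset (mset_set A) = \<Sum>A"
  by (simp add: sum_unfold_sum_mset)

lemma finite_count_sets:
  fixes p :: "'a multiset"
  shows "finite {i. odd (count p i)}" "finite {i. 2 \<le> count p i}"
proof -
  have "{i. odd (count p i)} \<subseteq> set_mset p" "{i. 2 \<le> count p i} \<subseteq> set_mset p"
    by (auto intro!: count_inI)
  then show "finite {i. odd (count p i)}" "finite {i. 2 \<le> count p i}"
    using finite_subset by blast+
qed

text \<open>A multiplicity at most 3 has two binary digits: whether it is odd, and whether it is at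
  least 2.\<close>

lemma simply_paired_decompose:
  assumes "simply_paired p"
  shows "mset_set {i. odd (count p i)} + repeat_mset 2 (mset_set {i. 2 \<le> count p i}) = p"
proof (rule multiset_eqI)
  fix i
  have "count p i \<in> {0, 1, 2, 3}"
    using assms unfolding simply_paired_def by (metis atMost_iff insertCI le_SucE le_zero_eq numeral_3_eq_3 One_nat_def numeral_2_eq_2)
  then show "count (mset_set {i. odd (count p i)} + repeat_mset 2 (mset_set {i. 2 \<le> count p i})) i
      = count p i"
    by (auto simp: count_mset_set' finite_count_sets)
qed

lemma largest_repeated_eq_max0: "largest_repeated p = max0 {i. 2 \<le> count p i}"
  unfolding largest_repeated_def max0_def
  using finite_count_sets(2)[of p] by (auto simp: Max_insert)

lemma odd_alt_sum_eq_alt_sum: "odd_alt_sum p = alt_sum {i. odd (count p i)}"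
  by (simp add: odd_alt_sum_def alt_sum_def odd_multiplicity_parts_def Let_def)

lemma A2_eq_card_set_pairs: "A2 n = card (set_pairs n)"
proof -
  let ?P = "{p \<in> partitions_of n. simply_paired p \<and> pairing_rank p = - 2}"
  let ?f = "\<lambda>p :: nat multiset. ({i. odd (count p i)}, {i. 2 \<le> count p i})"
  let ?g = "\<lambda>(U, R). mset_set U + repeat_mset 2 (mset_set R) :: nat multiset"
  have gf: "?g (?f p) = p" if "p \<in> ?P" for p
    using that simply_paired_decompose by simp
  have cnt: "count (?g (U, R)) i = of_bool (i \<in> U) + 2 * of_bool (i \<in> R)"
    if "finite U" "finite R" for U R i
    using that by (simp add: count_mset_set')
  have fg: "?f (?g x) = x" if "x \<in> set_pairs n" for x
    using that by (auto simp: set_pairs_def count_mset_set' split: if_splits)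
  have f: "?f p \<in> set_pairs n" if "p \<in> ?P" for p
  proof -
    have p: "0 \<notin># p" "sum_mset p = n" "simply_paired p" "pairing_rank p = - 2"
      using that by (auto simp: partitions_of_def)
    have "sum_mset (?g (?f p)) = n"
      using gf[OF that] p(2) by simp
    then have "\<Sum>{i. odd (count p i)} + 2 * \<Sum>{i. 2 \<le> count p i} = n"
      by (simp add: sum_mset_mset_set numeral_2_eq_2)
    then show ?thesis
      using p(1,4) by (auto simp: set_pairs_def finite_count_sets pairing_rank_def not_in_iff
          largest_repeated_eq_max0 odd_alt_sum_eq_alt_sum)
  qed
  have g: "?g x \<in> ?P" if mem: "x \<in> set_pairs n" for x
  proof -
    obtain U R where x: "x = (U, R)" "finite U" "finite R" "0 \<notin> U" "0 \<notin> R"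
      "\<Sum>U + 2 * \<Sum>R = n" "alt_sum U = int (max0 R) + 2"
      using mem by (auto simp: set_pairs_def)
    have "?f (?g x) = (U, R)"
      using fg[OF mem] x(1) by simp
    then have "pairing_rank (?g x) = - 2"
      using x(7) by (simp add: pairing_rank_def largest_repeated_eq_max0 odd_alt_sum_eq_alt_sum)
    moreover have "count (?g x) i \<le> 3" for i
      using cnt[OF x(2,3)] x(1) by simp
    moreover have "0 \<notin># ?g x" "sum_mset (?g x) = n"
      using x by (auto simp: sum_mset_mset_set numeral_2_eq_2)
    ultimately show ?thesis
      by (auto simp: partitions_of_def simply_paired_def)
  qed
  have "bij_betw ?f ?P (set_pairs n)"
    by (rule bij_betw_byWitness[where f' = ?g]) (use gf fg f g in auto)
  then show ?thesis
    unfolding A2_def by (rule bij_betw_same_card)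
qed

definition rep_gf :: "nat \<Rightarrow> 'a :: idom fps" where
  "rep_gf r = (\<Sum>R \<in> {R \<in> Pow {1..r}. max0 R = r}. fps_X ^ (2 * \<Sum>R))"

lemma max0_le_iff: "finite R \<Longrightarrow> max0 R \<le> r \<longleftrightarrow> (\<forall>i\<in>R. i \<le> r)"
  by (simp add: max0_def)

lemma subset_atLeastAtMost_sum:
  fixes U :: "nat set"
  assumes "finite U" "0 \<notin> U"
  shows "U \<subseteq> {1..\<Sum>U}"
proof
  fix u
  assume "u \<in> U"
  then have "u \<le> \<Sum>U"
    using assms(1) by (intro member_le_sum[of u U "\<lambda>i. i", simplified]) auto
  with \<open>u \<in> U\<close> assms(2) show "u \<in> {1..\<Sum>U}"
    by (cases u) auto
qed

text \<open>The pairs are sorted by \<open>r = max0 R\<close>, which is at most \<open>n\<close>.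
  The bound \<open>L\<close> only has to be large enough to contain every \<open>U\<close> of sum at
  most \<open>n\<close>; it stays free so that it can later be chosen beyond the reach of the
  truncation factors.\<close>

lemma A2_eq_coeff_sum:
  assumes "n \<le> L"
  shows "(of_nat (A2 n) :: 'a :: idom) = (\<Sum>r\<le>n. alt_gf L (r + 2) * rep_gf r) $ n"
proof -
  define A where "A r = {U \<in> Pow {1..L}. alt_sum U = int (r + 2)}" for r
  define B where "B r = {R \<in> Pow {1..r}. max0 R = r}" for r
  define S where "S r = {x \<in> A r \<times> B r. \<Sum>(fst x) + 2 * \<Sum>(snd x) = n}" for r
  have fin: "finite (A r)" "finite (B r)" for r
    by (auto simp: A_def B_def)
  have coeff: "(alt_gf L (r + 2) * rep_gf r) $ n = (of_nat (card (S r)) :: 'a)" for r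
  proof -
    have "alt_gf L (r + 2) * rep_gf r
        = (\<Sum>x\<in>A r \<times> B r. fps_X ^ (\<Sum>(fst x) + 2 * \<Sum>(snd x)) :: 'a fps)"
      unfolding alt_gf_def rep_gf_def A_def[symmetric] B_def[symmetric] sum_product
        sum.cartesian_product by (simp add: case_prod_beta power_add)
    then have "(alt_gf L (r + 2) * rep_gf r) $ n
        = (\<Sum>x\<in>A r \<times> B r. if \<Sum>(fst x) + 2 * \<Sum>(snd x) = n then 1 else (0 :: 'a))"
      by (simp add: fps_sum_nth fps_X_power_nth eq_commute)
    also have "\<dots> = of_nat (card (S r))"
      using fin by (simp add: S_def sum.If_cases Int_def)
    finally show ?thesis .
  qed
  have eq: "set_pairs n = (\<Union>r\<le>n. S r)"
  proof (intro equalityI subsetI)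
    fix x
    assume "x \<in> set_pairs n"
    then obtain U R where x: "x = (U, R)" "finite U" "finite R" "0 \<notin> U" "0 \<notin> R"
      "\<Sum>U + 2 * \<Sum>R = n" "alt_sum U = int (max0 R) + 2"
      by (auto simp: set_pairs_def)
    have "U \<subseteq> {1..L}"
      using subset_atLeastAtMost_sum[OF x(2,4)] x(6) assms by fastforce
    moreover have "max0 R \<le> n"
      using subset_atLeastAtMost_sum[OF x(3,5)] x(3,6) by (auto simp: max0_le_iff)
    moreover have "R \<subseteq> {1..max0 R}"
      using max0_le_iff[OF x(3), of "max0 R"] x(5) by (auto simp: Suc_le_eq intro: gr0I)
    ultimately have "x \<in> S (max0 R)" "max0 R \<le> n"
      using x by (auto simp: S_def A_def B_def)
    then show "x \<in> (\<Union>r\<le>n. S r)"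
      by blast
  next
    fix x
    assume "x \<in> (\<Union>r\<le>n. S r)"
    then obtain r where "x \<in> S r"
      by blast
    then show "x \<in> set_pairs n"
      by (auto simp: S_def A_def B_def set_pairs_def intro: finite_subset)
  qed
  have "card (set_pairs n) = (\<Sum>r\<le>n. card (S r))"
    unfolding eq by (rule card_UN_disjoint) (auto simp: fin S_def B_def)
  then show ?thesis
    by (simp add: A2_eq_card_set_pairs fps_sum_nth flip: coeff)
qed

section \<open>The generating function modulo 2\<close>

text \<open>These default rules would rewrite sums and products in \<open>bit\<close> to bitwise operations.\<close>

declare add_bit_eq_xor [simp del] mult_bit_eq_and [simp del] minus_bit_def [simp del]

lemma prod_one_plus:
  fixes f :: "'b \<Rightarrow> 'a :: comm_semiring_1"
  assumes "finite A"
  shows "(\<Prod>x\<in>A. 1 + f x) = (\<Sum>B\<in>Pow A. \<Prod>x\<in>B. f x)"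
  using prod_add[OF assms, of f "\<lambda>_. 1"] by (simp add: add.commute)

lemma max0_eq_Suc_sets:
  "{R \<in> Pow {1..Suc r}. max0 R = Suc r} = insert (Suc r) ` Pow {1..r}"
proof (intro equalityI subsetI)
  fix R
  assume "R \<in> {R \<in> Pow {1..Suc r}. max0 R = Suc r}"
  then have R: "R \<subseteq> {1..Suc r}" "max0 R = Suc r"
    by auto
  then have "finite R"
    using finite_subset by blast
  then have "Suc r \<in> insert 0 R"
    using R(2) Max_in[of "insert 0 R"] unfolding max0_def by auto
  then have "R = insert (Suc r) (R - {Suc r})"
    by auto
  moreover have "R - {Suc r} \<in> Pow {1..r}"
    using R(1) by (auto simp: le_Suc_eq)
  ultimately show "R \<in> insert (Suc r) ` Pow {1..r}"
    by blast
next
  fix R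
  assume "R \<in> insert (Suc r) ` Pow {1..r}"
  then obtain S where S: "R = insert (Suc r) S" "S \<subseteq> {1..r}"
    by auto
  then have "max0 R = Suc r"
    unfolding max0_def by (intro Max_eqI) (auto intro: finite_subset)
  with S show "R \<in> {R \<in> Pow {1..Suc r}. max0 R = Suc r}"
    by auto
qed

lemma rep_gf_0: "rep_gf 0 = 1"
proof -
  have "{R \<in> Pow {1..0}. max0 R = 0} = {{}}"
    by (auto simp: max0_def)
  then show ?thesis
    by (simp add: rep_gf_def)
qed

lemma rep_gf_Suc:
  "rep_gf (Suc r) = fps_X ^ (2 * Suc r) * (\<Prod>i = 1..r. 1 + (fps_X :: 'a :: idom fps) ^ (2 * i))"
proof -
  have "rep_gf (Suc r) = (\<Sum>R\<in>Pow {1..r}. (fps_X :: 'a fps) ^ (2 * (Suc r + \<Sum>R)))"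
    unfolding rep_gf_def max0_eq_Suc_sets
    by (subst sum.reindex[OF inj_on_insert_Suc]) (simp add: sum_insert_Suc)
  also have "\<dots> = fps_X ^ (2 * Suc r) * (\<Sum>R\<in>Pow {1..r}. fps_X ^ (2 * \<Sum>R))"
    by (simp only: sum_distrib_left power_add distrib_left)
  also have "(\<Sum>R\<in>Pow {1..r}. (fps_X :: 'a fps) ^ (2 * \<Sum>R)) = (\<Prod>i = 1..r. 1 + fps_X ^ (2 * i))"
    by (subst prod_one_plus) (simp_all add: sum_distrib_left power_sum)
  finally show ?thesis .
qed

lemma bit_fps_two_eq_0 [simp]: "(2 :: bit fps) = 0"
  by (metis bit_2_eq_0 fps_const_0_eq_0 fps_numeral_fps_const)

lemma bit_fps_add_self [simp]: "f + f = (0 :: bit fps)"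
  by (metis bit_fps_two_eq_0 mult_2 mult_zero_left)

lemma bit_fps_diff: "f - g = (f + g :: bit fps)"
  by (simp add: diff_eq_eq add.assoc)

text \<open>In characteristic 2 the signs disappear, and the numerator becomes a product that
  cancels most of the denominator of \<open>alt_gf\<close>.\<close>

lemma rep_gf_Suc_bit: "rep_gf (Suc r) = fps_X ^ (2 * Suc r) * (even_prod r :: bit fps)"
  by (simp add: rep_gf_Suc even_prod_def bit_fps_diff)

lemma fps_mult_prod_one_minus_nth:
  fixes f :: "'a :: idom fps"
  assumes "finite J" "\<And>j. j \<in> J \<Longrightarrow> n < j"
  shows "(f * (\<Prod>j\<in>J. 1 - fps_X ^ (2 * j))) $ n = f $ n"
  using assms
proof (induction J arbitrary: f)
  case (insert j J)
  then have "(f * (\<Prod>j\<in>insert j J. 1 - fps_X ^ (2 * j))) $ n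
      = ((f * (1 - fps_X ^ (2 * j))) * (\<Prod>j\<in>J. 1 - fps_X ^ (2 * j))) $ n"
    by (simp add: mult_ac)
  also have "\<dots> = (f * (1 - fps_X ^ (2 * j))) $ n"
    using insert by simp
  also have "\<dots> = f $ n - (fps_X ^ (2 * j) * f) $ n"
    by (simp add: algebra_simps)
  also have "(fps_X ^ (2 * j) * f) $ n = 0"
    using insert.prems[of j] by (simp add: fps_X_power_mult_nth)
  finally show ?case by simp
qed simp

text \<open>A truncated form of q^s / (q^2; q^2)_s: the surplus factors all have
  \<open>j > L - s\<close>, so by \<open>fps_mult_prod_one_minus_nth\<close> they do not affect the
  low coefficients.\<close>

lemma alt_gf_mult_even_prod:
  assumes "s \<le> L"
  shows "alt_gf L s * even_prod s
    = (fps_X :: 'a :: idom fps) ^ s * (\<Prod>j = Suc (L - s)..L. 1 - fps_X ^ (2 * j))"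
proof -
  have "even_prod L = (even_prod (L - s) :: 'a fps) * (\<Prod>j = Suc (L - s)..L. 1 - fps_X ^ (2 * j))"
    unfolding even_prod_def using prod.ub_add_nat[of 1 "L - s" _ s] assms by simp
  then have "even_prod (L - s) * (alt_gf L s * even_prod s)
    = even_prod (L - s) * ((fps_X :: 'a fps) ^ s * (\<Prod>j = Suc (L - s)..L. 1 - fps_X ^ (2 * j)))"
    using alt_gf_even_prod[OF assms, where ?'a = 'a] by (simp add: mult_ac)
  then show ?thesis
    by (simp only: mult_cancel_left even_prod_nz simp_thms)
qed

section \<open>Geometric series: cancellation and partial fractions\<close>

definition geom :: "nat \<Rightarrow> 'a :: idom fps" where
  "geom a = Abs_fps (\<lambda>n. of_bool (a dvd n))"

lemma geom_nth [simp]: "geom a $ n = of_bool (a dvd n)"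
  by (simp add: geom_def)

lemma one_minus_mult_geom:
  assumes "a > 0"
  shows "(1 - fps_X ^ a) * geom a = (1 :: 'a :: idom fps)"
proof (rule fps_ext)
  fix n
  have "a dvd n - a \<longleftrightarrow> a dvd n" if "a \<le> n"
    using that by (simp add: dvd_minus_self)
  moreover have "a dvd n \<longleftrightarrow> n = 0" if "n < a"
    using that assms by (auto dest: dvd_imp_le)
  moreover have "((1 - fps_X ^ a) * geom a) $ n
      = (geom a $ n - (if n < a then 0 else geom a $ (n - a)) :: 'a)"
    by (simp only: left_diff_distrib fps_sub_nth mult_1_left fps_X_power_mult_nth)
  ultimately show "((1 - fps_X ^ a) * geom a) $ n = (1 :: 'a fps) $ n"
    using assms by (cases "n < a") simp_all
qed

text \<open>Modulo 2 the factor \<open>even_prod (r - 1)\<close> of \<open>rep_gf r\<close> cancels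
  all but the last three factors of the denominator \<open>even_prod (r + 2)\<close>.\<close>

lemma alt_gf_mult_rep_gf_nth:
  assumes "r > 0" "r + 2 + n \<le> L"
  shows "(alt_gf L (r + 2) * rep_gf r) $ n
    = (fps_X ^ (3 * r + 2) * (geom (2 * r) * geom (2 * r + 2) * geom (2 * r + 4) :: bit fps)) $ n"
proof -
  obtain t where t: "r = Suc t"
    using assms(1) by (cases r) auto
  define J where "J = (\<Prod>j = Suc (L - (r + 2))..L. 1 - (fps_X :: bit fps) ^ (2 * j))"
  have "alt_gf L (r + 2) * even_prod (r + 2) = fps_X ^ (r + 2) * J"
    unfolding J_def by (rule alt_gf_mult_even_prod) (use assms in simp)
  moreover have "even_prod (r + 2) = (even_prod t * (1 - fps_X ^ (2 * r))
      * (1 - fps_X ^ (2 * r + 2)) * (1 - fps_X ^ (2 * r + 4)) :: bit fps)"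
    using t by (simp add: even_prod_Suc numeral_eq_Suc)
  ultimately have "alt_gf L (r + 2) * even_prod t * ((1 - fps_X ^ (2 * r))
      * (1 - fps_X ^ (2 * r + 2)) * (1 - fps_X ^ (2 * r + 4))) = fps_X ^ (r + 2) * J"
    by (simp add: mult_ac)
  moreover have "z * (a * b * c) * (A * B * C) = z * ((a * A) * (b * B) * (c * C))"
    for z a b c A B C :: "bit fps"
    by (simp only: mult_ac)
  ultimately have "alt_gf L (r + 2) * even_prod t * (((1 - fps_X ^ (2 * r)) * geom (2 * r))
      * ((1 - fps_X ^ (2 * r + 2)) * geom (2 * r + 2)) * ((1 - fps_X ^ (2 * r + 4)) * geom (2 * r + 4)))
      = fps_X ^ (r + 2) * J * (geom (2 * r) * geom (2 * r + 2) * geom (2 * r + 4))"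
    by metis
  then have "alt_gf L (r + 2) * even_prod t
      = fps_X ^ (r + 2) * J * (geom (2 * r) * geom (2 * r + 2) * geom (2 * r + 4))"
    using assms(1) by (simp only: one_minus_mult_geom zero_less_mult_iff zero_less_numeral
        add_pos_pos add_nonneg_pos zero_le mult_1_right simp_thms)
  moreover have "alt_gf L (r + 2) * rep_gf r = fps_X ^ (2 * r) * (alt_gf L (r + 2) * even_prod t :: bit fps)"
    unfolding t rep_gf_Suc_bit by (simp only: mult_ac)
  ultimately have "alt_gf L (r + 2) * rep_gf r
      = fps_X ^ (2 * r) * fps_X ^ (r + 2) * (geom (2 * r) * geom (2 * r + 2) * geom (2 * r + 4)) * J"
    by (simp only: mult_ac)
  also have "fps_X ^ (2 * r) * fps_X ^ (r + 2) = (fps_X :: bit fps) ^ (3 * r + 2)"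
    by (simp flip: power_add)
  finally show ?thesis
    unfolding J_def by (simp only:) (rule fps_mult_prod_one_minus_nth, use assms in auto)
qed

text \<open>The case \<open>r = 0\<close> is separate: \<open>rep_gf 0 = 1\<close> cancels nothing,
  and both factors of \<open>even_prod 2\<close> remain.\<close>

lemma alt_gf_2_nth:
  assumes "n + 2 \<le> L"
  shows "alt_gf L 2 $ n = (fps_X ^ 2 * (geom 2 * geom 4 :: bit fps)) $ n"
proof -
  define J where "J = (\<Prod>j = Suc (L - 2)..L. 1 - (fps_X :: bit fps) ^ (2 * j))"
  have "alt_gf L 2 * even_prod 2 = fps_X ^ 2 * J"
    unfolding J_def by (rule alt_gf_mult_even_prod) (use assms in simp)
  moreover have "even_prod 2 = ((1 - fps_X ^ 2) * (1 - fps_X ^ 4) :: bit fps)"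
    by (simp add: even_prod_Suc numeral_eq_Suc)
  ultimately have "alt_gf L 2 * (((1 - fps_X ^ 2) * geom 2) * ((1 - fps_X ^ 4) * geom 4))
      = fps_X ^ 2 * (geom 2 * geom 4) * J"
    by (simp add: mult_ac)
  then have "alt_gf L 2 = fps_X ^ 2 * (geom 2 * geom 4) * J"
    by (simp add: one_minus_mult_geom)
  then show ?thesis
    unfolding J_def by (simp only:) (rule fps_mult_prod_one_minus_nth, use assms in auto)
qed

text \<open>Put x, u, y for the powers with exponents \<open>4 * k\<close>,
  \<open>4 * k + 2\<close>, \<open>4 * k + 4\<close>, so that x y = u^2. Characteristic 2 gives (1 -
  u^2)^2 = 1 - u^4, hence 1 / (1 - u) = (1 + u) (1 - x y) / (1 - u^4), and (1 - x y) / ((1 - x) (1 -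
  y)) = 1 / (1 - y) + x / (1 - x). Only products of two geometric series remain.\<close>

lemma geom_product_identity:
  assumes "k > 0"
  shows "geom (4 * k) * geom (4 * k + 2) * geom (4 * k + 4)
    = (1 + fps_X ^ (4 * k + 2)) * geom (16 * k + 8)
      * (geom (4 * k + 4) + fps_X ^ (4 * k) * geom (4 * k) :: bit fps)"
proof -
  define x u y :: "bit fps" where
    "x = fps_X ^ (4 * k)" and "u = fps_X ^ (4 * k + 2)" and "y = fps_X ^ (4 * k + 4)"
  define X U Y W :: "bit fps" where
    "X = geom (4 * k)" and "U = geom (4 * k + 2)" and "Y = geom (4 * k + 4)"
    and "W = geom (16 * k + 8)"
  have inv: "(1 - x) * X = 1" "(1 - u) * U = 1" "(1 - y) * Y = 1"
    unfolding x_def u_def y_def X_def U_def Y_def by (rule one_minus_mult_geom; use assms in simp)+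
  have "(1 - fps_X ^ (16 * k + 8)) * W = 1"
    unfolding W_def by (rule one_minus_mult_geom) simp
  moreover have "fps_X ^ (16 * k + 8) = u ^ 4"
  proof -
    have "16 * k + 8 = (4 * k + 2) * 4"
      by simp
    then show ?thesis
      by (simp only: u_def power_mult)
  qed
  ultimately have W: "(1 - u ^ 4) * W = 1"
    by simp
  have xy: "x * y = u ^ 2"
  proof -
    have "4 * k + (4 * k + 4) = (4 * k + 2) * 2"
      by simp
    then show ?thesis
      by (simp only: x_def u_def y_def power_add[symmetric] power_mult[symmetric])
  qed
  have char2: "(1 - u ^ 2) ^ 2 = 1 - u ^ 4"
    unfolding power2_diff by (simp add: bit_fps_diff flip: power_mult)
  have "X * U * Y = X * U * Y * ((1 - u ^ 2) ^ 2 * W)"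
    unfolding char2 W by simp
  also have "\<dots> = (1 + u) * W * ((1 - u) * U) * (X * Y * (1 - x * y))"
    unfolding xy by algebra
  also have "X * Y * (1 - x * y) = ((1 - x) * X) * Y + x * X * ((1 - y) * Y)"
    by algebra
  finally show ?thesis
    unfolding inv by (simp add: x_def u_def X_def U_def Y_def W_def)
qed

section \<open>Coefficients as numbers of representations\<close>

lemma geom_geom_nth:
  assumes "a > 0" "b > 0"
  shows "(fps_X ^ e * (geom a * geom b)) $ n
    = (of_nat (card {(i, j). e + a * i + b * j = n}) :: 'a :: idom)"
proof (cases "n < e")
  case True
  then have "{(i, j). e + a * i + b * j = n} = {}"
    by auto
  with True show ?thesis
    by (simp only: fps_X_power_mult_nth card.empty) simp
next
  case False
  define S where "S = {l \<in> {0..n - e}. a dvd l \<and> b dvd n - e - l}"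
  have "bij_betw (\<lambda>(i, j). a * i) {(i, j). e + a * i + b * j = n} S"
  proof (rule bij_betw_byWitness[where f' = "\<lambda>l. (l div a, (n - e - l) div b)"])
    show "\<forall>x\<in>{(i, j). e + a * i + b * j = n}.
        (\<lambda>l. (l div a, (n - e - l) div b)) (case x of (i, j) \<Rightarrow> a * i) = x"
      using assms by auto
    show "\<forall>l\<in>S. (case (l div a, (n - e - l) div b) of (i, j) \<Rightarrow> a * i) = l"
      by (auto simp: S_def)
    show "(\<lambda>(i, j). a * i) ` {(i, j). e + a * i + b * j = n} \<subseteq> S"
      by (auto simp: S_def)
    show "(\<lambda>l. (l div a, (n - e - l) div b)) ` S \<subseteq> {(i, j). e + a * i + b * j = n}"
      using False by (auto simp: S_def)
  qed
  then have "card {(i, j). e + a * i + b * j = n} = card S"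
    by (rule bij_betw_same_card)
  moreover have "(fps_X ^ e * (geom a * geom b)) $ n = (of_nat (card S) :: 'a)"
  proof -
    have "(fps_X ^ e * (geom a * geom b)) $ n = (geom a * geom b :: 'a fps) $ (n - e)"
      using False by (simp only: fps_X_power_mult_nth if_False)
    also have "\<dots> = (\<Sum>l = 0..n - e. if a dvd l \<and> b dvd n - e - l then 1 else 0)"
      unfolding fps_mult_nth by (intro sum.cong) auto
    also have "\<dots> = of_nat (card S)"
      by (simp add: S_def sum.If_cases Int_def)
    finally show ?thesis .
  qed
  ultimately show ?thesis by simp
qed

lemma odd_nth_mult_eq_0:
  fixes f g :: "'a :: idom fps"
  assumes "\<And>n. odd n \<Longrightarrow> f $ n = 0" "\<And>n. odd n \<Longrightarrow> g $ n = 0" "odd n"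
  shows "(f * g) $ n = 0"
  unfolding fps_mult_nth
proof (rule sum.neutral, intro ballI)
  fix i
  assume "i \<in> {0..n}"
  then have "odd i \<or> odd (n - i)"
    using assms(3) by auto
  then show "f $ i * g $ (n - i) = 0"
    using assms(1)[of i] assms(2)[of "n - i"] by auto
qed

lemma geom_even_odd_nth: "odd n \<Longrightarrow> geom (2 * a) $ n = 0"
  by (auto dest: dvd_mult_left)

text \<open>For odd \<open>r\<close> the prefactor has odd exponent, while the three series contain
  only even powers.\<close>

lemma odd_rank_coeff:
  assumes "odd r" "even n"
  shows "(fps_X ^ (3 * r + 2) * (geom (2 * r) * geom (2 * r + 2) * geom (2 * r + 4) :: 'a :: idom fps)) $ n = 0"
proof -
  have "2 * r + 2 = 2 * (r + 1)" "2 * r + 4 = 2 * (r + 2)"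
    by simp_all
  then have *: "(geom (2 * r) * geom (2 * r + 2) * geom (2 * r + 4) :: 'a fps) $ m = 0" if "odd m" for m
    using that by (simp only:) (intro odd_nth_mult_eq_0 geom_even_odd_nth)
  show ?thesis
  proof (cases "n < 3 * r + 2")
    case False
    with assms have "odd (n - (3 * r + 2))"
      by simp
    from *[OF this] False show ?thesis
      by (simp only: fps_X_power_mult_nth if_False)
  qed (simp only: fps_X_power_mult_nth if_True)
qed

text \<open>
  For \<open>r = 2 k\<close>, the numerator \<open>q\<^bsup>6k+2\<^esup> (1 + q\<^bsup>4k+2\<^esup>)\<close> left by \<open>geom_product_identity\<close> has exactly
  one exponent divisible by 4.
\<close>

definition first_exponent :: "nat \<Rightarrow> nat" where
  "first_exponent k = (if odd k then 6 * k + 2 else 10 * k + 4)"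

text \<open>These and \<open>lower_reps\<close> index the contributions to q^(4M) of the two partial
  fractions, 1 / (1 - y) and x / (1 - x) respectively, in the notation of
  \<open>geom_product_identity\<close>.\<close>

definition upper_reps :: "nat \<Rightarrow> nat \<Rightarrow> (nat \<times> nat) set" where
  "upper_reps M k = {(c, b). first_exponent k + (16 * k + 8) * c + (4 * k + 4) * b = 4 * M}"

definition lower_reps :: "nat \<Rightarrow> nat \<Rightarrow> (nat \<times> nat) set" where
  "lower_reps M k = {(c, b). first_exponent k + 4 * k + (16 * k + 8) * c + (4 * k) * b = 4 * M}"

lemma even_rank_coeff:
  assumes "k > 0"
  shows "(fps_X ^ (3 * (2 * k) + 2)
      * (geom (2 * (2 * k)) * geom (2 * (2 * k) + 2) * geom (2 * (2 * k) + 4) :: bit fps)) $ (4 * M)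
    = of_nat (card (upper_reps M k) + card (lower_reps M k))"
proof -
  define N where "N e a b = {(c, d). e + a * c + b * d = 4 * M}" for e a b :: nat
  let ?e = "6 * k + 2" and ?f = "10 * k + 4" and ?w = "16 * k + 8"
  \<comment> \<open>Both step sizes are multiples of 4, so a constant term that is not one can never
    reach \<open>4 * M\<close>.\<close>
  have N0: "N e a b = {}" if "4 dvd a" "4 dvd b" "\<not> 4 dvd e" for e a b
  proof -
    have "e + a * c + b * d \<noteq> 4 * M" for c d
      using that by (metis dvd_add_left_iff dvd_mult2 dvd_triv_left)
    then show ?thesis
      by (simp add: N_def)
  qed
  have "fps_X ^ (3 * (2 * k) + 2)
      * (geom (2 * (2 * k)) * geom (2 * (2 * k) + 2) * geom (2 * (2 * k) + 4) :: bit fps)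
    = fps_X ^ ?e * ((1 + fps_X ^ (4 * k + 2)) * geom ?w
      * (geom (4 * k + 4) + fps_X ^ (4 * k) * geom (4 * k)))"
    using geom_product_identity[OF assms] by simp
  also have "\<dots> = fps_X ^ ?e * (geom ?w * geom (4 * k + 4))
      + (fps_X ^ ?e * fps_X ^ (4 * k)) * (geom ?w * geom (4 * k))
      + (fps_X ^ ?e * fps_X ^ (4 * k + 2)) * (geom ?w * geom (4 * k + 4))
      + (fps_X ^ ?e * fps_X ^ (4 * k + 2) * fps_X ^ (4 * k)) * (geom ?w * geom (4 * k))"
    by algebra
  also have "\<dots> = fps_X ^ ?e * (geom ?w * geom (4 * k + 4))
      + fps_X ^ (?e + 4 * k) * (geom ?w * geom (4 * k))
      + fps_X ^ ?f * (geom ?w * geom (4 * k + 4))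
      + fps_X ^ (?f + 4 * k) * (geom ?w * geom (4 * k))"
  proof -
    have "?e + (4 * k + 2) = ?f"
      by simp
    then show ?thesis
      by (simp only: power_add[symmetric])
  qed
  finally have eq: "(fps_X ^ (3 * (2 * k) + 2)
      * (geom (2 * (2 * k)) * geom (2 * (2 * k) + 2) * geom (2 * (2 * k) + 4) :: bit fps)) $ (4 * M)
    = of_nat (card (N ?e ?w (4 * k + 4))) + of_nat (card (N (?e + 4 * k) ?w (4 * k)))
      + of_nat (card (N ?f ?w (4 * k + 4))) + of_nat (card (N (?f + 4 * k) ?w (4 * k)))"
    using assms by (simp add: fps_add_nth geom_geom_nth N_def del: fps_X_power_mult_nth power_add power_add_numeral power_Suc)
  have w: "4 dvd ?w" "4 dvd 4 * k + 4" "4 dvd 4 * k"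
    by presburger+
  show ?thesis
  proof (cases "odd k")
    case True
    then have "\<not> 4 dvd ?f" "\<not> 4 dvd ?f + 4 * k"
      by presburger+
    then have "N ?f ?w (4 * k + 4) = {}" "N (?f + 4 * k) ?w (4 * k) = {}"
      using N0 w by blast+
    with eq True show ?thesis
      by (simp add: upper_reps_def lower_reps_def first_exponent_def N_def)
  next
    case False
    then have "\<not> 4 dvd ?e" "\<not> 4 dvd ?e + 4 * k"
      by presburger+
    then have "N ?e ?w (4 * k + 4) = {}" "N (?e + 4 * k) ?w (4 * k) = {}"
      using N0 w by blast+
    with eq False show ?thesis
      by (simp add: upper_reps_def lower_reps_def first_exponent_def N_def)
  qed
qed

text \<open>Here \<open>j < M\<close> is free and forces \<open>i = 2 * (M - j) - 1\<close>.\<close>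

lemma card_zero_rank: "card {(i, j). 2 + 2 * i + 4 * j = 4 * (M :: nat)} = M"
proof -
  have "bij_betw snd {(i, j). 2 + 2 * i + 4 * j = 4 * M} {..<M}"
    by (rule bij_betw_byWitness[where f' = "\<lambda>j. (2 * (M - j) - 1, j)"]) auto
  then show ?thesis
    by (simp add: bij_betw_same_card)
qed

lemma sum_even_indices:
  fixes g :: "nat \<Rightarrow> 'a :: comm_monoid_add"
  assumes "\<And>r. odd r \<Longrightarrow> g r = 0"
  shows "(\<Sum>r\<le>2 * m. g r) = g 0 + (\<Sum>k = 1..m. g (2 * k))"
  by (induction m) (simp_all add: assms add.assoc)

lemma A2_4_parity:
  "of_nat (A2 (4 * M)) = (of_nat (M + (\<Sum>k = 1..2 * M. card (upper_reps M k) + card (lower_reps M k))) :: bit)"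
proof -
  \<comment> \<open>The least \<open>L\<close> with \<open>r + 2 + 4 * M \<le> L\<close> for every
    \<open>r \<le> 4 * M\<close>.\<close>
  define L where "L = 8 * M + 2"
  define g :: "nat \<Rightarrow> bit" where "g r = (alt_gf L (r + 2) * rep_gf r) $ (4 * M)" for r
  define h :: "nat \<Rightarrow> bit" where "h r = (if r = 0 then of_nat M else
    (fps_X ^ (3 * r + 2) * (geom (2 * r) * geom (2 * r + 2) * geom (2 * r + 4))) $ (4 * M))" for r
  have g: "g r = h r" if "r \<le> 4 * M" for r
  proof (cases "r = 0")
    case True
    have "g 0 = (fps_X ^ 2 * (geom 2 * geom 4 :: bit fps)) $ (4 * M)"
      using alt_gf_2_nth[of "4 * M" L] by (simp add: g_def rep_gf_0 L_def numeral_2_eq_2)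
    also have "\<dots> = of_nat M"
      by (simp only: geom_geom_nth zero_less_numeral card_zero_rank)
    finally show ?thesis
      using True by (simp add: h_def)
  next
    case False
    then show ?thesis
      unfolding g_def h_def using alt_gf_mult_rep_gf_nth[of r "4 * M" L] that by (simp add: L_def)
  qed
  have "of_nat (A2 (4 * M)) = (\<Sum>r\<le>4 * M. g r)"
    using A2_eq_coeff_sum[of "4 * M" L] by (simp add: g_def L_def fps_sum_nth)
  also have "\<dots> = (\<Sum>r\<le>2 * (2 * M). h r)"
    using g by (intro sum.cong) auto
  also have "\<dots> = h 0 + (\<Sum>k = 1..2 * M. h (2 * k))"
  proof (rule sum_even_indices)
    fix r :: nat
    assume "odd r"
    then have "r \<noteq> 0"
      by (cases r) auto
    moreover have "even (4 * M)"
      by simp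
    ultimately show "h r = 0"
      using odd_rank_coeff[OF \<open>odd r\<close>, of "4 * M", where ?'a = bit]
      by (simp only: h_def if_False)
  qed
  also have "(\<Sum>k = 1..2 * M. h (2 * k))
      = (\<Sum>k = 1..2 * M. of_nat (card (upper_reps M k) + card (lower_reps M k)))"
  proof (rule sum.cong[OF refl])
    fix k
    assume "k \<in> {1..2 * M}"
    then show "h (2 * k) = of_nat (card (upper_reps M k) + card (lower_reps M k))"
      unfolding h_def using even_rank_coeff[of k M] by simp
  qed
  finally show ?thesis
    by (simp only: h_def of_nat_add of_nat_sum simp_thms if_True)
qed

section \<open>Odd divisors and nearest multiples\<close>

text \<open>For positive \<open>d\<close>, twice this number is the even multiplier bringing
  \<open>d\<close> closest to \<open>N\<close>, with ties going to the larger multiple. The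
  remainder then lies in the half-open interval [-d, d).\<close>

definition nearest_quotient :: "nat \<Rightarrow> nat \<Rightarrow> nat" where
  "nearest_quotient N d = (N div d + 1) div 2"

definition nearest_remainder :: "nat \<Rightarrow> nat \<Rightarrow> int" where
  "nearest_remainder N d = int N - 2 * int d * int (nearest_quotient N d)"

lemma nearest_remainder_bounds:
  assumes "d > 0"
  shows "- int d \<le> nearest_remainder N d" "nearest_remainder N d < int d"
proof -
  define q r where "q = N div d" and "r = N mod d"
  have N: "int N = int d * int q + int r"
    unfolding q_def r_def by (metis mult_div_mod_eq of_nat_add of_nat_mult)
  have r: "r < d"
    using assms by (simp add: r_def)
  consider g where "q = 2 * g" | g where "q = 2 * g + 1"
    by (meson oddE evenE)
  then have "- int d \<le> nearest_remainder N d \<and> nearest_remainder N d < int d"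
    using r by cases (auto simp: nearest_remainder_def nearest_quotient_def N algebra_simps simp flip: q_def)
  then show "- int d \<le> nearest_remainder N d" "nearest_remainder N d < int d"
    by blast+
qed

text \<open>Two such remainders differ by a multiple of \<open>2 * d\<close>, but lie in a half-open
  interval of that length.\<close>

lemma nearest_quotient_unique:
  assumes "int N = 2 * int d * int g + t" "- int d \<le> t" "t < int d"
  shows "nearest_quotient N d = g" "nearest_remainder N d = t"
proof -
  let ?f = "nearest_quotient N d" and ?s = "nearest_remainder N d"
  have d: "d > 0"
    using assms by simp
  have "2 * int d * int ?f + ?s = 2 * int d * int g + t"
    using assms(1) by (simp add: nearest_remainder_def)
  then have eq: "t - ?s = 2 * int d * (int ?f - int g)"
    by (simp add: algebra_simps)
  have "\<bar>t - ?s\<bar> < 2 * int d"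
    using nearest_remainder_bounds[OF d, of N] assms by linarith
  then have "(2 * int d) * \<bar>int ?f - int g\<bar> < (2 * int d) * 1"
    unfolding eq by (simp add: abs_mult)
  then have "\<bar>int ?f - int g\<bar> < 1"
    using d mult_less_cancel_left_pos[of "2 * int d"] by simp
  then show f: "?f = g"
    by simp
  then show "?s = t"
    using eq by simp
qed

lemma mult_le_imp_le_nat: "0 < d \<Longrightarrow> d * x \<le> N \<Longrightarrow> x \<le> (N :: nat)"
  by (rule order_trans[of _ "d * x"]) simp_all

lemma card_odd_le: "card {e. odd e \<and> e \<le> (q :: nat)} = (q + 1) div 2"
proof (induction q)
  case (Suc q)
  have "{e. odd e \<and> e \<le> Suc q} = (if odd (Suc q) then insert (Suc q) else id) {e. odd e \<and> e \<le> q}"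
    by (auto simp: le_Suc_eq)
  then show ?case
    using Suc by auto
qed (auto intro: odd_pos)

lemma card_3_mod_4_le: "card {e. e mod 4 = 3 \<and> e \<le> (q :: nat)} = (q + 1) div 4"
proof (induction q)
  case (Suc q)
  have "{e. e mod 4 = 3 \<and> e \<le> Suc q}
      = (if Suc q mod 4 = 3 then insert (Suc q) else id) {e. e mod 4 = 3 \<and> e \<le> q}"
    by (auto simp: le_Suc_eq)
  moreover have "finite {e. e mod 4 = 3 \<and> e \<le> q}"
    by simp
  ultimately have "card {e. e mod 4 = 3 \<and> e \<le> Suc q} = (q + 1) div 4 + of_bool (Suc q mod 4 = 3)"
    using Suc by simp
  also have "\<dots> = (Suc q + 1) div 4"
    by (cases "Suc q mod 4 = 3"; simp; presburger)
  finally show ?case .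
qed auto

text \<open>Among the first f odd numbers 1, 3, 5, ... exactly \<open>f div 2\<close> are 3 modulo
  4.\<close>

lemma card_odd_cofactors:
  assumes "d > 0"
  shows "card {e. odd e \<and> d * e \<le> N} = nearest_quotient N d"
    and "card {e. e mod 4 = 3 \<and> d * e \<le> N} = nearest_quotient N d div 2"
proof -
  have le: "d * e \<le> N \<longleftrightarrow> e \<le> N div d" for e
    using assms by (simp add: less_eq_div_iff_mult_less_eq mult.commute)
  show "card {e. odd e \<and> d * e \<le> N} = nearest_quotient N d"
    unfolding le card_odd_le by (simp add: nearest_quotient_def)
  show "card {e. e mod 4 = 3 \<and> d * e \<le> N} = nearest_quotient N d div 2"
    unfolding le card_3_mod_4_le nearest_quotient_def div_mult2_eq[symmetric] by simp
qed

section \<open>Parity of the number of critical divisors\<close>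

definition critical :: "nat \<Rightarrow> nat \<Rightarrow> bool" where
  "critical N d \<longleftrightarrow> nearest_remainder N d mod 8 \<in> {3, 5}"

text \<open>Let f be the quotient. The remainder is 4y + 1 or 4y - 1 according to whether f is even
  or odd, with y = M - d (f div 2) - (f mod 2) (d - 1) / 2, and \<open>critical\<close> means that y
  is odd. Since (d - 1) / 2 is odd exactly for d = 3 modulo 4, the parity follows. The full f
  replaces \<open>f mod 2\<close> so that summing over d counts pairs.\<close>

lemma critical_iff:
  assumes "odd d"
  shows "critical (4 * M + 1) d \<longleftrightarrow> odd (M + nearest_quotient (4 * M + 1) d div 2
    + (if d mod 4 = 3 then nearest_quotient (4 * M + 1) d else 0))"
proof -
  define f where "f = nearest_quotient (4 * M + 1) d"
  have t: "nearest_remainder (4 * M + 1) d = 4 * int M + 1 - 2 * int d * int f"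
    by (simp add: nearest_remainder_def f_def)
  have "d = 4 * (d div 4) + 1 \<or> d = 4 * (d div 4) + 3"
    using assms by presburger
  then obtain a where a: "d = 4 * a + 1 \<or> d = 4 * a + 3"
    by blast
  obtain g where g: "f = 2 * g \<or> f = 2 * g + 1"
    by (meson oddE evenE)
  have mod8: "(4 * y + 1) mod 8 \<in> {3, 5} \<longleftrightarrow> odd y" "(4 * y - 1) mod 8 \<in> {3, 5} \<longleftrightarrow> odd y"
    for y :: int
    by (simp, presburger)+
  let ?z = "int M - 4 * int (a * g)"
  consider "d = 4 * a + 1" "f = 2 * g" | "d = 4 * a + 3" "f = 2 * g"
    | "d = 4 * a + 1" "f = 2 * g + 1" | "d = 4 * a + 3" "f = 2 * g + 1"
    using a g by blast
  then show ?thesis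
    unfolding critical_def f_def[symmetric]
  proof cases
    case 1
    then have "nearest_remainder (4 * M + 1) d = 4 * (?z - int g) + 1"
      unfolding t by (simp add: algebra_simps)
    moreover have "d mod 4 = 1"
      unfolding 1 by presburger
    ultimately show "nearest_remainder (4 * M + 1) d mod 8 \<in> {3, 5}
        \<longleftrightarrow> odd (M + f div 2 + (if d mod 4 = 3 then f else 0))"
      unfolding 1(2) by (simp only: mod8) auto
  next
    case 2
    then have "nearest_remainder (4 * M + 1) d = 4 * (?z - 3 * int g) + 1"
      unfolding t by (simp add: algebra_simps)
    moreover have "d mod 4 = 3"
      unfolding 2 by presburger
    ultimately show "nearest_remainder (4 * M + 1) d mod 8 \<in> {3, 5}
        \<longleftrightarrow> odd (M + f div 2 + (if d mod 4 = 3 then f else 0))"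
      unfolding 2(2) by (simp only: mod8) auto
  next
    case 3
    then have "nearest_remainder (4 * M + 1) d = 4 * (?z - 2 * int a - int g) - 1"
      unfolding t by (simp add: algebra_simps)
    moreover have "d mod 4 = 1"
      unfolding 3 by presburger
    ultimately show "nearest_remainder (4 * M + 1) d mod 8 \<in> {3, 5}
        \<longleftrightarrow> odd (M + f div 2 + (if d mod 4 = 3 then f else 0))"
      unfolding 3(2) by (simp only: mod8) auto
  next
    case 4
    then have "nearest_remainder (4 * M + 1) d = 4 * (?z - 2 * int a - 3 * int g - 1) - 1"
      unfolding t by (simp add: algebra_simps)
    moreover have "d mod 4 = 3"
      unfolding 4 by presburger
    ultimately show "nearest_remainder (4 * M + 1) d mod 8 \<in> {3, 5}
        \<longleftrightarrow> odd (M + f div 2 + (if d mod 4 = 3 then f else 0))"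
      unfolding 4(2) by (simp only: mod8) auto
  qed
qed

definition odd_upto :: "nat \<Rightarrow> nat set" where
  "odd_upto N = {d. odd d \<and> d \<le> N}"

lemma finite_odd_upto [simp]: "finite (odd_upto N)"
  by (simp add: odd_upto_def)

text \<open>Both sums over quotients count pairs of odd numbers with product at most
  \<open>4 * M + 1\<close>, one factor being 3 modulo 4: the second factor in one sum, the first in
  the other. Swapping the factors shows that they are equal, so they cancel modulo 2 and leave
  \<open>M\<close> for each of the \<open>2 * M + 1\<close> values of \<open>d\<close>.\<close>

lemma odd_card_critical:
  "odd (card {d \<in> odd_upto (4 * M + 1). critical (4 * M + 1) d}) \<longleftrightarrow> odd M"
proof -
  let ?N = "4 * M + 1"
  let ?D = "odd_upto ?N" and ?f = "nearest_quotient ?N"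
  have pos: "d > 0" if "d \<in> ?D" for d
    using that by (auto simp: odd_upto_def intro: gr0I)
  have fin: "finite {e. Q e \<and> d * e \<le> ?N}" if "d > 0" for d Q
  proof (rule finite_subset)
    show "{e. Q e \<and> d * e \<le> ?N} \<subseteq> {..?N}"
      using that by (auto dest: mult_le_imp_le_nat)
  qed simp
  have "(\<Sum>d\<in>?D. ?f d div 2) = (\<Sum>d\<in>?D. card {e. e mod 4 = 3 \<and> d * e \<le> ?N})"
    using pos by (intro sum.cong) (simp_all add: card_odd_cofactors)
  also have "\<dots> = card (SIGMA d:?D. {e. e mod 4 = 3 \<and> d * e \<le> ?N})"
    using pos fin by simp
  also have "(SIGMA d:?D. {e. e mod 4 = 3 \<and> d * e \<le> ?N})
      = prod.swap ` (SIGMA d:{d \<in> ?D. d mod 4 = 3}. {e. odd e \<and> d * e \<le> ?N})"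
    (is "?A = prod.swap ` ?B")
  proof (intro equalityI subsetI)
    fix x
    assume "x \<in> ?A"
    then obtain d e where x: "x = (d, e)" and d: "odd d" "e mod 4 = 3" "d * e \<le> ?N"
      by (auto simp: odd_upto_def)
    then have "odd e"
      by presburger
    moreover have "e \<le> ?N"
      using mult_le_imp_le_nat[of d e ?N] d(1,3) by (auto intro: odd_pos)
    ultimately have "(e, d) \<in> ?B"
      using d by (auto simp: odd_upto_def mult.commute)
    then show "x \<in> prod.swap ` ?B"
      unfolding x by force
  next
    fix x
    assume "x \<in> prod.swap ` ?B"
    then obtain d e where x: "x = (d, e)" and d: "odd d" "e mod 4 = 3" "e * d \<le> ?N" "odd e"
      by (auto simp: odd_upto_def)
    then have "d \<le> ?N"
      using mult_le_imp_le_nat[of e d ?N] by (auto intro: odd_pos)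
    then show "x \<in> ?A"
      using x d by (auto simp: odd_upto_def mult.commute)
  qed
  also have "card \<dots> = card (SIGMA d:{d \<in> ?D. d mod 4 = 3}. {e. odd e \<and> d * e \<le> ?N})"
    by (rule card_image) simp
  also have "\<dots> = (\<Sum>d\<in>{d \<in> ?D. d mod 4 = 3}. card {e. odd e \<and> d * e \<le> ?N})"
    using pos fin by simp
  also have "\<dots> = (\<Sum>d\<in>{d \<in> ?D. d mod 4 = 3}. ?f d)"
    using pos by (intro sum.cong) (simp_all add: card_odd_cofactors)
  also have "\<dots> = (\<Sum>d\<in>?D. if d mod 4 = 3 then ?f d else 0)"
    by (subst sum.inter_filter) simp_all
  finally have sym: "(\<Sum>d\<in>?D. ?f d div 2) = (\<Sum>d\<in>?D. if d mod 4 = 3 then ?f d else 0)" .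
  have card: "card ?D = 2 * M + 1"
    unfolding odd_upto_def card_odd_le by simp
  have "{d \<in> ?D. critical ?N d}
      = {d \<in> ?D. odd (M + ?f d div 2 + (if d mod 4 = 3 then ?f d else 0))}"
  proof -
    have "critical ?N d \<longleftrightarrow> odd (M + ?f d div 2 + (if d mod 4 = 3 then ?f d else 0))"
      if "d \<in> ?D" for d
    proof (rule critical_iff)
      show "odd d"
        using that by (simp add: odd_upto_def)
    qed
    then show ?thesis
      by blast
  qed
  then have "odd (card {d \<in> ?D. critical ?N d})
      \<longleftrightarrow> odd (\<Sum>d\<in>?D. M + ?f d div 2 + (if d mod 4 = 3 then ?f d else 0))"
    by (simp add: even_sum_iff)
  also have "(\<Sum>d\<in>?D. M + ?f d div 2 + (if d mod 4 = 3 then ?f d else 0))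
      = M * (2 * M + 1) + 2 * (\<Sum>d\<in>?D. ?f d div 2)"
    by (simp only: sum.distrib sum_constant sym card) simp
  finally show ?thesis
    by simp
qed

section \<open>Critical divisors by sign of the remainder, and their representations\<close>

lemma nearest_quotient_pos:
  assumes "d \<in> odd_upto N"
  shows "nearest_quotient N d > 0"
proof -
  have "0 < d" "d \<le> N"
    using assms by (auto simp: odd_upto_def intro: gr0I)
  then have "N div d > 0"
    by (simp add: div_greater_zero_iff)
  then show ?thesis
    by (simp add: nearest_quotient_def)
qed

text \<open>Combined with \<open>critical\<close>, the parity of the quotient thus fixes the
  remainder modulo 8.\<close>

lemma nearest_remainder_mod_4:
  assumes "odd d"
  shows "nearest_remainder (4 * M + 1) d mod 4
    = (if odd (nearest_quotient (4 * M + 1) d) then 3 else 1)"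
proof -
  obtain a where "d = 2 * a + 1"
    using assms by (elim oddE)
  moreover define f z where "f = nearest_quotient (4 * M + 1) d" and "z = int (a * f)"
  ultimately have "nearest_remainder (4 * M + 1) d = 4 * int M + 1 - (4 * z + 2 * int f)"
    by (simp add: nearest_remainder_def algebra_simps)
  then show ?thesis
    unfolding f_def[symmetric] by presburger
qed

text \<open>These divisors would correspond to \<open>k = 0\<close> in \<open>upper_reps\<close>,
  which the sum over positive \<open>k\<close> omits. With quotient 1 the negative critical
  remainders are -5 - 8i, that is, \<open>d = 2 * M + 3 + 4 * i\<close>, and
  \<open>d \<le> 4 * M + 1\<close> bounds \<open>i\<close>.\<close>

lemma card_critical_boundary:
  "card {d \<in> odd_upto (4 * M + 1). critical (4 * M + 1) d \<and> nearest_remainder (4 * M + 1) d < 0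
     \<and> nearest_quotient (4 * M + 1) d = 1} = (M + 1) div 2"
  (is "card ?E = _")
proof -
  let ?N = "4 * M + 1"
  have "?E = (\<lambda>i. 2 * M + 3 + 4 * i) ` {..<(M + 1) div 2}"
  proof (intro equalityI subsetI)
    fix d
    assume "d \<in> ?E"
    then have "odd d" "d \<le> ?N" and t: "nearest_remainder ?N d mod 8 \<in> {3, 5}"
      "nearest_remainder ?N d < 0" "nearest_quotient ?N d = 1"
      by (auto simp: odd_upto_def critical_def)
    have "nearest_remainder ?N d = 4 * int M + 1 - 2 * int d"
      using t(3) by (simp add: nearest_remainder_def)
    with \<open>odd d\<close> \<open>d \<le> ?N\<close> t(1,2) have d: "odd d" "d \<le> ?N"
      "(4 * int M + 1 - 2 * int d) mod 8 \<in> {3, 5}" "4 * int M + 1 < 2 * int d"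
      by simp_all
    obtain j where j: "d = 2 * j + 1"
      using d(1) by (elim oddE)
    define y where "y = int M - int j"
    have "4 * int M + 1 - 2 * int d = 4 * y - 1"
      using j by (simp add: y_def)
    with d(3) have "odd y"
      by simp presburger
    moreover have "M \<le> j"
      using d(4) j by linarith
    ultimately obtain i where "j = M + 1 + 2 * i"
      unfolding y_def by (metis add.assoc even_diff le_add_diff_inverse oddE of_nat_diff
          even_of_nat dvd_minus_iff minus_diff_eq add.commute)
    then have "d = 2 * M + 3 + 4 * i \<and> i < (M + 1) div 2"
      using d(2) j by auto
    then show "d \<in> (\<lambda>i. 2 * M + 3 + 4 * i) ` {..<(M + 1) div 2}"
      by blast
  next
    fix d
    assume "d \<in> (\<lambda>i. 2 * M + 3 + 4 * i) ` {..<(M + 1) div 2}"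
    then obtain i where i: "d = 2 * M + 3 + 4 * i" "i < (M + 1) div 2"
      by blast
    then have d: "odd d" "d \<le> ?N"
      by auto
    have "nearest_quotient ?N d = 1" "nearest_remainder ?N d = - 5 - 8 * int i"
      by (rule nearest_quotient_unique[where g = 1 and t = "- 5 - 8 * int i"]; use i in simp)+
    moreover have "(- 5 - 8 * int i) mod 8 = 3"
      by presburger
    ultimately show "d \<in> ?E"
      using d by (simp add: odd_upto_def critical_def)
  qed
  moreover have "inj_on (\<lambda>i. 2 * M + 3 + 4 * i) {..<(M + 1) div 2}"
    by (rule inj_onI) simp
  ultimately show ?thesis
    by (simp add: card_image)
qed

text \<open>Chosen so that \<open>first_exponent k + 1 = (2 * k + 1) * parity_offset k\<close>; this
  factorisation is the reason for working with \<open>4 * M + 1\<close>.\<close>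

definition parity_offset :: "nat \<Rightarrow> nat" where
  "parity_offset k = (if odd k then 3 else 5)"

text \<open>
  With \<open>d\<close> the second factor on the right, the next two equations say that \<open>(2 k + 1) d\<close> lies below,
  respectively above, \<open>4 M + 1\<close> by less than \<open>d\<close>: this is why a triple \<open>(k, c, b)\<close> is recovered from \<open>d\<close>.
\<close>

lemma mem_upper_reps:
  "(c, b) \<in> upper_reps M k \<longleftrightarrow> 4 * M + 1 = (2 * k + 1) * (8 * c + parity_offset k + 2 * b) + 2 * b"
  by (auto simp: upper_reps_def first_exponent_def parity_offset_def algebra_simps)

lemma mem_lower_reps:
  "(c, b) \<in> lower_reps M k \<longleftrightarrow>
    4 * M + 1 + 2 * (b + 1) = (2 * k + 1) * (8 * c + parity_offset k + 2 * (b + 1))"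
  by (auto simp: lower_reps_def first_exponent_def parity_offset_def algebra_simps)

text \<open>With \<open>d = 8 * c + parity_offset k + 2 * b\<close> the equation reads N = 2 d (k +
  1) - (8 c + \<open>parity_offset k\<close>). The quotient returns \<open>k\<close>, the remainder
  then \<open>c\<close>, and \<open>d\<close> itself \<open>b\<close>. Quotient 1 is excluded
  because \<open>k\<close> starts at 1.\<close>

lemma sum_card_upper_reps:
  "(\<Sum>k = 1..2 * M. card (upper_reps M k))
    = card {d \<in> odd_upto (4 * M + 1). critical (4 * M + 1) d
        \<and> nearest_remainder (4 * M + 1) d < 0 \<and> nearest_quotient (4 * M + 1) d \<noteq> 1}"
  (is "_ = card ?P")
proof -
  let ?N = "4 * M + 1"
  let ?S = "SIGMA k:{1..2 * M}. upper_reps M k"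
  let ?d = "\<lambda>(k, c, b). 8 * c + parity_offset k + 2 * b"
  have fin: "finite (upper_reps M k)" for k
  proof (rule finite_subset)
    have "c \<le> ?N" "b \<le> ?N" if "(c, b) \<in> upper_reps M k" for c b
      using that mult_le_imp_le_nat[of "16 * k + 8" c ?N] mult_le_imp_le_nat[of "4 * k + 4" b ?N]
      by (simp_all add: upper_reps_def)
    then show "upper_reps M k \<subseteq> {..?N} \<times> {..?N}"
      by auto
  qed simp
  have nq: "nearest_quotient ?N (?d (k, c, b)) = k + 1"
    "nearest_remainder ?N (?d (k, c, b)) = - int (8 * c + parity_offset k)"
    if "(c, b) \<in> upper_reps M k" for k c b
  proof -
    have "int ?N = int ((2 * k + 1) * (8 * c + parity_offset k + 2 * b) + 2 * b)"
      using that by (simp only: mem_upper_reps)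
    then have "int ?N = 2 * int (?d (k, c, b)) * int (k + 1) + - int (8 * c + parity_offset k)"
      by (simp add: algebra_simps)
    then show "nearest_quotient ?N (?d (k, c, b)) = k + 1"
      "nearest_remainder ?N (?d (k, c, b)) = - int (8 * c + parity_offset k)"
      by (rule nearest_quotient_unique; simp add: parity_offset_def)+
  qed
  have inj: "inj_on ?d ?S"
  proof (rule inj_onI)
    fix x y
    assume "x \<in> ?S" "y \<in> ?S" and eq: "?d x = ?d y"
    obtain k c b k' c' b' where xy: "x = (k, c, b)" "y = (k', c', b')"
      by (metis prod_cases3)
    with \<open>x \<in> ?S\<close> \<open>y \<in> ?S\<close> have "(c, b) \<in> upper_reps M k" "(c', b') \<in> upper_reps M k'"
      by auto
    then have "k + 1 = k' + 1" "int (8 * c + parity_offset k) = int (8 * c' + parity_offset k')"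
      using nq[of c b k] nq[of c' b' k'] eq xy by simp_all
    with eq xy show "x = y"
      by simp
  qed
  have im: "?d ` ?S = ?P"
  proof (intro equalityI subsetI)
    fix d
    assume "d \<in> ?d ` ?S"
    then obtain k c b where k: "d = ?d (k, c, b)" "k \<ge> 1" "(c, b) \<in> upper_reps M k"
      by auto
    have "odd d"
      using k(1) by (simp add: parity_offset_def)
    moreover have "d \<le> ?N"
      using k(1,3) by (simp add: mem_upper_reps)
    moreover have "- int (8 * c + parity_offset k) mod 8 \<in> {3, 5}"
      by (simp add: parity_offset_def; presburger)
    ultimately show "d \<in> ?P"
      using nq[OF k(3)] k(1,2) by (simp add: odd_upto_def critical_def parity_offset_def)
  next
    fix d
    assume d: "d \<in> ?P"
    define f t where "f = nearest_quotient ?N d" and "t = nearest_remainder ?N d"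
    have *: "odd d" "t mod 8 \<in> {3, 5}" "t < 0" "f \<noteq> 1" "f > 0"
      using d nearest_quotient_pos[of d ?N] by (auto simp: odd_upto_def critical_def f_def t_def)
    define k where "k = f - 1"
    have k: "f = k + 1" "k \<ge> 1"
      using * by (auto simp: k_def)
    have "- int d \<le> t"
      unfolding t_def using *(1) by (intro nearest_remainder_bounds) (auto intro: gr0I)
    have t4: "t mod 4 = (if odd f then 3 else 1)"
      unfolding t_def f_def using *(1) by (rule nearest_remainder_mod_4)
    define c where "c = nat ((- t) div 8)"
    \<comment> \<open>\<open>k = f - 1\<close> has the opposite parity to f, so odd \<open>k\<close>
      means t = 1 modulo 4, and criticality lifts this to 5 modulo 8.\<close>
    have c: "- t = int (8 * c + parity_offset k)"
    proof -
      have "(- t) mod 8 = int (parity_offset k)"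
      proof (cases "odd k")
        case True
        then have "t mod 4 = 1"
          using t4 k by simp
        then have "t mod 8 = 5"
          using *(2) by simp presburger
        then have "(- t) mod 8 = 3"
          by (simp add: zmod_zminus1_eq_if)
        then show ?thesis
          using True by (simp add: parity_offset_def)
      next
        case False
        then have "t mod 4 = 3"
          using t4 k by simp
        then have "t mod 8 = 3"
          using *(2) by simp presburger
        then have "(- t) mod 8 = 5"
          by (simp add: zmod_zminus1_eq_if)
        then show ?thesis
          using False by (simp add: parity_offset_def)
      qed
      moreover have "int c = (- t) div 8"
        unfolding c_def using *(3) by (simp add: pos_imp_zdiv_nonneg_iff)
      ultimately show ?thesis
        using mult_div_mod_eq[of 8 "- t"] by simp
    qed
    define b where "b = nat ((int d + t) div 2)"
    have b: "int d + t = 2 * int b"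
      using t4 *(1) \<open>- int d \<le> t\<close> unfolding b_def by (simp split: if_splits; presburger)
    have dd: "d = ?d (k, c, b)"
      using b c by simp
    have "int ?N = 2 * int d * int (k + 1) + t"
      using k(1) unfolding t_def f_def by (simp add: nearest_remainder_def)
    also have "\<dots> = int ((2 * k + 1) * d + 2 * b)"
      using b by (simp add: algebra_simps)
    finally have "?N = (2 * k + 1) * d + 2 * b"
      by (simp only: of_nat_eq_iff)
    then have "(c, b) \<in> upper_reps M k"
      unfolding mem_upper_reps using dd by simp
    moreover have "k \<le> 2 * M"
      using calculation by (auto simp: upper_reps_def first_exponent_def split: if_splits)
    ultimately show "d \<in> ?d ` ?S"
      using dd k(2) by (intro image_eqI[of _ _ "(k, c, b)"]) auto
  qed
  have "card ?S = card ?P"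
    using card_image[OF inj] unfolding im by simp
  then show ?thesis
    using fin by simp
qed

text \<open>Now N = 2 d k + (8 c + \<open>parity_offset k\<close>), so the quotient is
  \<open>k\<close> itself. It is positive for every odd \<open>d \<le> N\<close>, hence no divisor
  is lost at the boundary.\<close>

lemma sum_card_lower_reps:
  "(\<Sum>k = 1..2 * M. card (lower_reps M k))
    = card {d \<in> odd_upto (4 * M + 1). critical (4 * M + 1) d \<and> nearest_remainder (4 * M + 1) d > 0}"
  (is "_ = card ?Q")
proof -
  let ?N = "4 * M + 1"
  let ?S = "SIGMA k:{1..2 * M}. lower_reps M k"
  let ?d = "\<lambda>(k, c, b). 8 * c + parity_offset k + 2 * (b + 1)"
  have fin: "finite (lower_reps M k)" if "k > 0" for k
  proof (rule finite_subset)
    have "c \<le> ?N" "b \<le> ?N" if "(c, b) \<in> lower_reps M k" for c b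
      using that \<open>k > 0\<close> mult_le_imp_le_nat[of "16 * k + 8" c ?N] mult_le_imp_le_nat[of "4 * k" b ?N]
      by (simp_all add: lower_reps_def)
    then show "lower_reps M k \<subseteq> {..?N} \<times> {..?N}"
      by auto
  qed simp
  have nq: "nearest_quotient ?N (?d (k, c, b)) = k"
    "nearest_remainder ?N (?d (k, c, b)) = int (8 * c + parity_offset k)"
    if "(c, b) \<in> lower_reps M k" for k c b
  proof -
    have "int (?N + 2 * (b + 1)) = int ((2 * k + 1) * (8 * c + parity_offset k + 2 * (b + 1)))"
      using that by (simp only: mem_lower_reps)
    then have "int ?N = 2 * int (?d (k, c, b)) * int k + int (8 * c + parity_offset k)"
      by (simp add: algebra_simps)
    then show "nearest_quotient ?N (?d (k, c, b)) = k"
      "nearest_remainder ?N (?d (k, c, b)) = int (8 * c + parity_offset k)"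
      by (rule nearest_quotient_unique; simp)+
  qed
  have inj: "inj_on ?d ?S"
  proof (rule inj_onI)
    fix x y
    assume "x \<in> ?S" "y \<in> ?S" and eq: "?d x = ?d y"
    obtain k c b k' c' b' where xy: "x = (k, c, b)" "y = (k', c', b')"
      by (metis prod_cases3)
    with \<open>x \<in> ?S\<close> \<open>y \<in> ?S\<close> have "(c, b) \<in> lower_reps M k" "(c', b') \<in> lower_reps M k'"
      by auto
    then have "k = k'" "int (8 * c + parity_offset k) = int (8 * c' + parity_offset k')"
      using nq[of c b k] nq[of c' b' k'] eq xy by simp_all
    with eq xy show "x = y"
      by simp
  qed
  have im: "?d ` ?S = ?Q"
  proof (intro equalityI subsetI)
    fix d
    assume "d \<in> ?d ` ?S"
    then obtain k c b where k: "d = ?d (k, c, b)" "k \<ge> 1" "(c, b) \<in> lower_reps M k"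
      by auto
    have "odd d"
      using k(1) by (simp add: parity_offset_def)
    moreover have "d \<le> ?N"
    proof -
      have "1 * (2 * (b + 1)) + d \<le> 2 * k * d + d"
        using k(1,2) by (intro add_mono mult_mono) auto
      also have "\<dots> = ?N + 2 * (b + 1)"
        using k(1,3) by (simp add: mem_lower_reps algebra_simps)
      finally show ?thesis by simp
    qed
    moreover have "int (8 * c + parity_offset k) mod 8 \<in> {3, 5}"
      by (simp add: parity_offset_def; presburger)
    ultimately show "d \<in> ?Q"
      using nq[OF k(3)] k(1,2) by (simp add: odd_upto_def critical_def parity_offset_def)
  next
    fix d
    assume d: "d \<in> ?Q"
    define k t where "k = nearest_quotient ?N d" and "t = nearest_remainder ?N d"
    have *: "odd d" "t mod 8 \<in> {3, 5}" "t > 0" "k > 0"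
      using d nearest_quotient_pos[of d ?N] by (auto simp: odd_upto_def critical_def k_def t_def)
    have "t < int d"
      unfolding t_def using *(1) by (intro nearest_remainder_bounds) (auto intro: gr0I)
    have t4: "t mod 4 = (if odd k then 3 else 1)"
      unfolding t_def k_def using *(1) by (rule nearest_remainder_mod_4)
    define c where "c = nat (t div 8)"
    have c: "t = int (8 * c + parity_offset k)"
    proof -
      have "t mod 8 = int (parity_offset k)"
      proof (cases "odd k")
        case True
        then have "t mod 4 = 3"
          using t4 by simp
        then have "t mod 8 = 3"
          using *(2) by simp presburger
        then show ?thesis
          using True by (simp add: parity_offset_def)
      next
        case False
        then have "t mod 4 = 1"
          using t4 by simp
        then have "t mod 8 = 5"
          using *(2) by simp presburger
        then show ?thesis
          using False by (simp add: parity_offset_def)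
      qed
      moreover have "int c = t div 8"
        unfolding c_def using *(3) by (simp add: pos_imp_zdiv_nonneg_iff)
      ultimately show ?thesis
        using mult_div_mod_eq[of 8 t] by simp
    qed
    \<comment> \<open>Since \<open>t < d\<close> is strict and both are odd, \<open>d - t\<close> is
      at least 2; this is where the shift \<open>b + 1\<close> comes from.\<close>
    define b where "b = nat ((int d - t) div 2 - 1)"
    have b: "int d - t = 2 * int (b + 1)"
      using t4 *(1) \<open>t < int d\<close> unfolding b_def by (simp split: if_splits; presburger)
    have dd: "d = ?d (k, c, b)"
      using b c by simp
    have "int (?N + 2 * (b + 1)) = 2 * int d * int k + t + 2 * int (b + 1)"
      unfolding t_def k_def by (simp add: nearest_remainder_def)
    also have "\<dots> = int ((2 * k + 1) * d)"
      using b by (simp add: algebra_simps)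
    finally have "?N + 2 * (b + 1) = (2 * k + 1) * d"
      by (simp only: of_nat_eq_iff)
    then have "(c, b) \<in> lower_reps M k"
      unfolding mem_lower_reps using dd by simp
    moreover have "k \<le> 2 * M"
      using calculation by (auto simp: lower_reps_def first_exponent_def split: if_splits)
    ultimately show "d \<in> ?d ` ?S"
      using dd *(4) by (intro image_eqI[of _ _ "(k, c, b)"]) auto
  qed
  have "card ?S = card ?Q"
    using card_image[OF inj] unfolding im by simp
  then show ?thesis
    using fin by simp
qed

text \<open>The critical divisors, \<open>M\<close> in number modulo 2, are those counted by the
  representations together with the \<open>(M + 1) div 2\<close> boundary ones; the difference is
  \<open>M div 2\<close>.\<close>

lemma odd_sum_card_reps:
  "odd (\<Sum>k = 1..2 * M. card (upper_reps M k) + card (lower_reps M k)) \<longleftrightarrow> odd (M div 2)"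
proof -
  let ?N = "4 * M + 1"
  let ?t = "nearest_remainder ?N" and ?f = "nearest_quotient ?N"
  let ?C = "{d \<in> odd_upto ?N. critical ?N d}"
  let ?P = "{d \<in> odd_upto ?N. critical ?N d \<and> ?t d < 0 \<and> ?f d \<noteq> 1}"
  let ?Q = "{d \<in> odd_upto ?N. critical ?N d \<and> ?t d > 0}"
  let ?E = "{d \<in> odd_upto ?N. critical ?N d \<and> ?t d < 0 \<and> ?f d = 1}"
  have "?t d \<noteq> 0" if "critical ?N d" for d
    using that by (auto simp: critical_def)
  then have "?C = ?P \<union> ?Q \<union> ?E"
    by (auto simp: neq_iff)
  then have "card ?C = card (?P \<union> ?Q \<union> ?E)"
    by simp
  also have "\<dots> = card ?P + card ?Q + card ?E"
    by (subst card_Un_disjoint; (subst card_Un_disjoint)?) auto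
  finally have "card ?C = (\<Sum>k = 1..2 * M. card (upper_reps M k) + card (lower_reps M k)) + (M + 1) div 2"
    unfolding sum.distrib sum_card_upper_reps sum_card_lower_reps card_critical_boundary .
  moreover have "odd (card ?C) \<longleftrightarrow> odd M"
    by (rule odd_card_critical)
  ultimately show ?thesis
    by presburger
qed

lemma of_nat_bit: "(of_nat n :: bit) = of_bool (odd n)"
  by (induction n) (simp_all add: one_add_one)

lemma of_nat_bit_eq_iff: "(of_nat m :: bit) = of_nat n \<longleftrightarrow> (odd m \<longleftrightarrow> odd n)"
  by (simp add: of_nat_bit)

lemma odd_A2_iff: "odd (A2 (4 * M)) \<longleftrightarrow> odd (M + M div 2)"
  using A2_4_parity[of M] odd_sum_card_reps[of M] by (simp add: of_nat_bit_eq_iff del: of_nat_add of_nat_sum)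

theorem corollary7p4:
  fixes n :: nat
  shows "[A2 (16 * n) = 0] (mod 2) \<and> [A2 (16 * n + 4) = 1] (mod 2) \<and>
    [A2 (16 * n + 8) = 1] (mod 2) \<and> [A2 (16 * n + 12) = 0] (mod 2)"
proof -
  \<comment> \<open>For \<open>M = 4 * n + j\<close> the number \<open>M + M div 2\<close> is
    \<open>6 * n + j + j div 2\<close>, so only \<open>j\<close> matters for its parity.\<close>
  have "odd (A2 (16 * n + 4 * j)) \<longleftrightarrow> odd (j + j div 2)" for j
    using odd_A2_iff[of "4 * n + j"] by (simp add: algebra_simps) presburger
  from this[of 0] this[of 1] this[of 2] this[of 3] show ?thesis
    by (simp add: cong_def odd_iff_mod_2_eq_one even_iff_mod_2_eq_zero)
qed

end
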